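(* For $0<p<1$, the real quasi-normed space $\ell_p$ is light.
   Context: $\ell_p$ ($0<p<1$) is the space of real sequences $x=(x_k)_{k\in\mathbb{N}}$ with $\sum_k|x_k|^p<\infty$, with the quasi-norm $\|x\|_p=(\sum_k|x_k|^p)^{1/p}$. For a quasi-normed space $X$ with continuous dual $X^*$, $\mathrm{Isom}(X)$ is the group of surjective linear isometries; the Strong Operator Topology is the topology of pointwise quasi-norm convergence on $X$, and the Weak Operator Topology is generated by the maps $T\mapsto x^*(Tx)$, $x\in X$, $x^*\in X^*$. $X$ is light if these two topologies coincide on $\mathrm{Isom}(X)$. *)

theory Defs
  imports "HOL-Analysis.Analysis" "HOL-Library.Function_Algebras"
begin

instantiation "fun" :: (type, real_vector) real_vector
begin

definition scaleR_fun :: "real \<Rightarrow> ('a \<Rightarrow> 'b) \<Rightarrow> 'a \<Rightarrow> 'b"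
  where "scaleR_fun c f = (\<lambda>x. c *\<^sub>R f x)"

instance
  by standard (auto simp: scaleR_fun_def fun_eq_iff algebra_simps)

end

text \<open>A quasi-normed space is given by a linear subspace \<open>V\<close> of an ambient real vector space,
  together with a function \<open>N\<close> whose values matter only on \<open>V\<close>.\<close>

locale quasi_normed_space =
  fixes V :: "'a::real_vector set" and N :: "'a \<Rightarrow> real"
  assumes subspace: "subspace V"
    and nonneg: "x \<in> V \<Longrightarrow> 0 \<le> N x"
    and eq_0_iff: "x \<in> V \<Longrightarrow> N x = 0 \<longleftrightarrow> x = 0"
    and scale: "x \<in> V \<Longrightarrow> N (c *\<^sub>R x) = \<bar>c\<bar> * N x"
    and quasi_triangle: "\<exists>K\<ge>1. \<forall>x\<in>V. \<forall>y\<in>V. N (x + y) \<le> K * (N x + N y)"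

text \<open>The balls of a quasi-norm are neighbourhoods of their centres but need not be open, so
  they do not themselves form a base.\<close>

definition qn_open :: "'a::real_vector set \<Rightarrow> ('a \<Rightarrow> real) \<Rightarrow> 'a set \<Rightarrow> bool" where
  "qn_open V N U \<longleftrightarrow> U \<subseteq> V \<and> (\<forall>x\<in>U. \<exists>e>0. \<forall>y\<in>V. N (y - x) < e \<longrightarrow> y \<in> U)"

definition qn_topology :: "'a::real_vector set \<Rightarrow> ('a \<Rightarrow> real) \<Rightarrow> 'a topology" where
  "qn_topology V N = topology (qn_open V N)"

definition linear_between ::
    "'a::real_vector set \<Rightarrow> 'b::real_vector set \<Rightarrow> ('a \<Rightarrow> 'b) \<Rightarrow> bool" where
  "linear_between V W T \<longleftrightarrow> T ` V \<subseteq> W \<and>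
     (\<forall>x\<in>V. \<forall>y\<in>V. T (x + y) = T x + T y) \<and> (\<forall>c. \<forall>x\<in>V. T (c *\<^sub>R x) = c *\<^sub>R T x)"

text \<open>Maps defined on \<open>V\<close> only are represented by HOL functions in \<open>extensional V\<close>, so that
  equality of maps is equality on \<open>V\<close>.\<close>

definition continuous_dual :: "'a::real_vector set \<Rightarrow> ('a \<Rightarrow> real) \<Rightarrow> ('a \<Rightarrow> real) set" where
  "continuous_dual V N = {\<phi> \<in> extensional V.
     linear_between V UNIV \<phi> \<and> continuous_map (qn_topology V N) euclideanreal \<phi>}"

definition Isom :: "'a::real_vector set \<Rightarrow> ('a \<Rightarrow> real) \<Rightarrow> ('a \<Rightarrow> 'a) set" where
  "Isom V N = {T \<in> extensional V.
     linear_between V V T \<and> T ` V = V \<and> (\<forall>x\<in>V. N (T x) = N x)}"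

text \<open>The coarsest topology on \<open>S\<close> making every map \<open>ev i\<close>, \<open>i \<in> I\<close>, from \<open>S\<close> to \<open>Y\<close>
  continuous. (For \<open>I \<noteq> {}\<close> and \<open>ev i ` S \<subseteq> topspace Y\<close> its underlying set is \<open>S\<close>.)\<close>

definition initial_topology :: "'s set \<Rightarrow> 'i set \<Rightarrow> ('i \<Rightarrow> 's \<Rightarrow> 'b) \<Rightarrow> 'b topology \<Rightarrow> 's topology"
  where "initial_topology S I ev Y =
    topology_generated_by {{s \<in> S. ev i s \<in> U} |i U. i \<in> I \<and> openin Y U}"

definition SOT :: "'a::real_vector set \<Rightarrow> ('a \<Rightarrow> real) \<Rightarrow> ('a \<Rightarrow> 'a) topology" where
  "SOT V N = initial_topology (Isom V N) V (\<lambda>x T. T x) (qn_topology V N)"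

definition WOT :: "'a::real_vector set \<Rightarrow> ('a \<Rightarrow> real) \<Rightarrow> ('a \<Rightarrow> 'a) topology" where
  "WOT V N = initial_topology (Isom V N) (V \<times> continuous_dual V N)
     (\<lambda>(x, \<phi>) T. \<phi> (T x)) euclideanreal"

definition light :: "'a::real_vector set \<Rightarrow> ('a \<Rightarrow> real) \<Rightarrow> bool" where
  "light V N \<longleftrightarrow> SOT V N = WOT V N"

definition lp :: "real \<Rightarrow> (nat \<Rightarrow> real) set" where
  "lp p = {x. summable (\<lambda>k. \<bar>x k\<bar> powr p)}"

definition lp_norm :: "real \<Rightarrow> (nat \<Rightarrow> real) \<Rightarrow> real" where
  "lp_norm p x = (\<Sum>k. \<bar>x k\<bar> powr p) powr (1 / p)"

lemma istopology_qn_open: "istopology (qn_open V N)"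
  unfolding istopology_def
proof (intro conjI allI impI)
  fix S T assume S: "qn_open V N S" and T: "qn_open V N T"
  show "qn_open V N (S \<inter> T)"
    unfolding qn_open_def
  proof (intro conjI ballI)
    show "S \<inter> T \<subseteq> V" using S by (auto simp: qn_open_def)
    fix x assume "x \<in> S \<inter> T"
    then obtain d e where d: "d > 0" "\<forall>y\<in>V. N (y - x) < d \<longrightarrow> y \<in> S"
      and e: "e > 0" "\<forall>y\<in>V. N (y - x) < e \<longrightarrow> y \<in> T"
      using S T unfolding qn_open_def by (metis IntE)
    then show "\<exists>e>0. \<forall>y\<in>V. N (y - x) < e \<longrightarrow> y \<in> S \<inter> T"
      by (intro exI[of _ "min d e"]) auto
  qed
next
  fix \<K> assume "\<forall>K\<in>\<K>. qn_open V N K"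
  then show "qn_open V N (\<Union>\<K>)"
    unfolding qn_open_def by (meson Union_iff Union_least)
qed

lemma openin_qn_topology: "openin (qn_topology V N) U \<longleftrightarrow> qn_open V N U"
  unfolding qn_topology_def by (simp add: istopology_qn_open)

lemma topspace_qn_topology: "topspace (qn_topology V N) = V"
proof -
  have "qn_open V N V" by (auto simp: qn_open_def intro: exI[of _ 1])
  then show ?thesis
    unfolding topspace_def openin_qn_topology by (auto simp: qn_open_def)
qed

lemma topspace_initial_topology:
  assumes "i \<in> I" and "\<And>s. s \<in> S \<Longrightarrow> ev i s \<in> topspace Y"
  shows "topspace (initial_topology S I ev Y) = S"
proof -
  have "{s \<in> S. ev i s \<in> topspace Y} \<in> {{s \<in> S. ev i s \<in> U} |i U. i \<in> I \<and> openin Y U}"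
    using assms(1) by blast
  moreover have "{s \<in> S. ev i s \<in> topspace Y} = S" using assms(2) by auto
  ultimately show ?thesis
    unfolding initial_topology_def topology_generated_by_topspace by blast
qed

lemma powr_add_le_add_powr:
  fixes a b p :: real
  assumes "0 \<le> a" "0 \<le> b" "0 < p" "p \<le> 1"
  shows "(a + b) powr p \<le> a powr p + b powr p"
proof (cases "a + b = 0")
  case False
  then have s: "a + b > 0" using assms by simp
  have *: "t \<le> t powr p" if "0 \<le> t" "t \<le> 1" for t :: real
    using powr_mono'[of p 1 t] that assms by simp
  have "1 = a / (a + b) + b / (a + b)" using s by (simp flip: add_divide_distrib)
  also have "\<dots> \<le> (a / (a + b)) powr p + (b / (a + b)) powr p"
    using assms s by (intro add_mono *) auto
  also have "\<dots> = (a powr p + b powr p) / (a + b) powr p"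
    using assms s by (simp add: powr_divide add_divide_distrib)
  finally show ?thesis using s by (simp flip: add_divide_distrib)
qed (use assms in auto)

lemma quasi_normed_space_lp:
  assumes p: "0 < p" "p < 1"
  shows "quasi_normed_space (lp p) (lp_norm p)"
proof
  have le: "\<bar>x k + y k\<bar> powr p \<le> \<bar>x k\<bar> powr p + \<bar>y k\<bar> powr p" for x y :: "nat \<Rightarrow> real" and k
  proof -
    have "\<bar>x k + y k\<bar> powr p \<le> (\<bar>x k\<bar> + \<bar>y k\<bar>) powr p"
      using p by (intro powr_mono2) auto
    then show ?thesis using powr_add_le_add_powr[of "\<bar>x k\<bar>" "\<bar>y k\<bar>" p] p by simp
  qed
  have sum: "summable (\<lambda>k. \<bar>x k + y k\<bar> powr p)" if "x \<in> lp p" "y \<in> lp p" for x y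
    by (rule summable_comparison_test'[where N = 0 and g = "\<lambda>k. \<bar>x k\<bar> powr p + \<bar>y k\<bar> powr p"])
      (use that le in \<open>auto simp: lp_def intro: summable_add\<close>)
  have pow: "\<bar>c * x k\<bar> powr p = \<bar>c\<bar> powr p * \<bar>x k\<bar> powr p" for c and x :: "nat \<Rightarrow> real" and k
    by (simp add: abs_mult powr_mult)
  show "subspace (lp p)"
    unfolding subspace_def
  proof (intro conjI ballI allI)
    show "0 \<in> lp p" by (simp add: lp_def)
    show "x + y \<in> lp p" if "x \<in> lp p" "y \<in> lp p" for x y
      using sum[OF that] by (simp add: lp_def)
    show "c *\<^sub>R x \<in> lp p" if "x \<in> lp p" for c x
      using that by (simp add: lp_def scaleR_fun_def pow summable_mult)
  qed
  show "0 \<le> lp_norm p x" for x by (simp add: lp_norm_def)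
  show "lp_norm p x = 0 \<longleftrightarrow> x = 0" if "x \<in> lp p" for x
    using that by (auto simp: lp_norm_def lp_def suminf_eq_zero_iff fun_eq_iff)
  show "lp_norm p (c *\<^sub>R x) = \<bar>c\<bar> * lp_norm p x" if "x \<in> lp p" for c x
  proof -
    have "(\<Sum>k. \<bar>x k\<bar> powr p) \<ge> 0" using that by (simp add: lp_def suminf_nonneg)
    then show ?thesis
      using that p
      by (simp add: lp_norm_def lp_def scaleR_fun_def pow suminf_mult powr_mult powr_powr)
  qed
  show "\<exists>K\<ge>1. \<forall>x\<in>lp p. \<forall>y\<in>lp p. lp_norm p (x + y) \<le> K * (lp_norm p x + lp_norm p y)"
  proof (intro exI[of _ "2 powr (1 / p)"] conjI ballI)
    show "1 \<le> 2 powr (1 / p)" using p by (simp add: ge_one_powr_ge_zero)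
    fix x y assume xy: "x \<in> lp p" "y \<in> lp p"
    define A where "A = (\<Sum>k. \<bar>x k\<bar> powr p)"
    define B where "B = (\<Sum>k. \<bar>y k\<bar> powr p)"
    have nn: "A \<ge> 0" "B \<ge> 0" using xy by (auto simp: A_def B_def lp_def suminf_nonneg)
    have "(\<Sum>k. \<bar>x k + y k\<bar> powr p) \<le> (\<Sum>k. \<bar>x k\<bar> powr p + \<bar>y k\<bar> powr p)"
      using xy by (intro suminf_le le sum) (auto simp: lp_def intro: summable_add)
    also have "\<dots> = A + B"
      unfolding A_def B_def using xy by (intro suminf_add[symmetric]) (auto simp: lp_def)
    also have "\<dots> \<le> 2 * max A B" by simp
    finally have "lp_norm p (x + y) \<le> (2 * max A B) powr (1 / p)"
      using sum[OF xy] p by (simp add: lp_norm_def powr_mono2 suminf_nonneg)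
    also have "\<dots> = 2 powr (1 / p) * max A B powr (1 / p)" using nn by (simp add: powr_mult)
    also have "\<dots> \<le> 2 powr (1 / p) * (A powr (1 / p) + B powr (1 / p))"
      by (intro mult_left_mono) (auto simp: max_def)
    finally show "lp_norm p (x + y) \<le> 2 powr (1 / p) * (lp_norm p x + lp_norm p y)"
      by (simp add: lp_norm_def A_def B_def)
  qed
qed

end

theory Submission
  imports Defs
begin

text \<open>Isometries preserve \<open>\<Sum>k. \<bar>x k\<bar> powr p\<close>. Among vectors \<open>y\<close> with the same such sum
  as a given \<open>z\<close>, closeness to \<open>z\<close> on the first \<open>n\<close> coordinates forces closeness in
  quasi-norm: once these coordinates carry almost all the mass of \<open>z\<close>, they carry almost all
  the mass of \<open>y\<close> too, so both tails are small. Since coordinates are continuous functionals,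
  this gives a weak neighbourhood inside every basic strong one. The converse inclusion
  holds in every space.\<close>

lemma openin_initial_topologyI:
  assumes "i \<in> I" "openin Y U"
  shows "openin (initial_topology S I ev Y) {s \<in> S. ev i s \<in> U}"
  unfolding initial_topology_def using assms by (intro topology_generated_by_Basis) blast

text \<open>Reduces both inclusions between the operator topologies to subbasic sets: a generated
  topology is the coarsest one containing its generators.\<close>

lemma initial_topology_coarsest:
  assumes "\<And>i U. i \<in> I \<Longrightarrow> openin Y U \<Longrightarrow> openin X {s \<in> S. ev i s \<in> U}"
    and "openin (initial_topology S I ev Y) W"
  shows "openin X W"
proof (rule generate_topology_on_coarsest)
  show "generate_topology_on {{s \<in> S. ev i s \<in> U} |i U. i \<in> I \<and> openin Y U} W"
    using assms(2) by (simp add: initial_topology_def openin_topology_generated_by_iff)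
qed (use assms(1) in auto)

lemma continuous_map_initial_topology:
  assumes "i \<in> I" and "\<And>s. s \<in> S \<Longrightarrow> ev i s \<in> topspace Y"
  shows "continuous_map (initial_topology S I ev Y) Y (ev i)"
proof -
  have "topspace (initial_topology S I ev Y) = S"
    using assms by (rule topspace_initial_topology)
  then show ?thesis
    unfolding continuous_map using assms openin_initial_topologyI[OF assms(1), of Y] by auto
qed

text \<open>Pulling \<open>U\<close> back along the continuous \<open>\<phi>\<close> turns a
  subbasic weak set at \<open>x\<close> into a subbasic strong set at the same
  \<open>x\<close>.\<close>

lemma WOT_le_SOT:
  assumes "openin (WOT V N) W"
  shows "openin (SOT V N) W"
proof (rule initial_topology_coarsest[OF _ assms[unfolded WOT_def]], clarify)
  fix x \<phi> and U :: "real set"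
  assume x: "x \<in> V" and \<phi>: "\<phi> \<in> continuous_dual V N" and U: "openin euclideanreal U"
  have "openin (qn_topology V N) {y \<in> V. \<phi> y \<in> U}"
    using \<phi> U openin_continuous_map_preimage[of "qn_topology V N" euclideanreal \<phi> U]
    by (simp add: continuous_dual_def topspace_qn_topology)
  then have "openin (SOT V N) {T \<in> Isom V N. T x \<in> {y \<in> V. \<phi> y \<in> U}}"
    unfolding SOT_def by (intro openin_initial_topologyI x)
  moreover have "{T \<in> Isom V N. T x \<in> {y \<in> V. \<phi> y \<in> U}} = {T \<in> Isom V N. \<phi> (T x) \<in> U}"
    using x by (auto simp: Isom_def)
  ultimately show "openin (SOT V N) {T \<in> Isom V N. \<phi> (T x) \<in> U}" by simp
qed

text \<open>Subadditivity of the power \<open>p\<close> gives a triangle inequality without a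
  constant for the sums of \<open>p\<close>-th powers, which is why the estimates below use these
  sums instead of \<open>lp_norm\<close>.\<close>

lemma abs_diff_powr_le:
  fixes a b p :: real
  assumes "0 < p" "p \<le> 1"
  shows "\<bar>a - b\<bar> powr p \<le> \<bar>a\<bar> powr p + \<bar>b\<bar> powr p"
proof -
  have "\<bar>a - b\<bar> powr p \<le> (\<bar>a\<bar> + \<bar>b\<bar>) powr p"
    using assms by (intro powr_mono2) auto
  then show ?thesis using powr_add_le_add_powr[of "\<bar>a\<bar>" "\<bar>b\<bar>" p] assms by simp
qed

lemma lp_diff:
  assumes "0 < p" "p < 1" "x \<in> lp p" "y \<in> lp p"
  shows "x - y \<in> lp p"
  using assms quasi_normed_space.subspace[OF quasi_normed_space_lp] subspace_diff by blast

text \<open>A single term of a nonnegative series is at most its sum. This bound makes coordinates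
  continuous.\<close>

lemma abs_coord_le_lp_norm:
  assumes "0 < p" "x \<in> lp p"
  shows "\<bar>x k\<bar> \<le> lp_norm p x"
proof -
  have "\<bar>x k\<bar> powr p \<le> (\<Sum>k. \<bar>x k\<bar> powr p)"
    using assms sum_le_suminf[of "\<lambda>k. \<bar>x k\<bar> powr p" "{k}"] by (simp add: lp_def)
  then have "(\<bar>x k\<bar> powr p) powr (1 / p) \<le> lp_norm p x"
    unfolding lp_norm_def using assms by (intro powr_mono2) auto
  then show ?thesis using assms by (simp add: powr_powr)
qed

lemma coord_in_continuous_dual:
  assumes p: "0 < p" "p < 1"
  shows "restrict (\<lambda>x. x k) (lp p) \<in> continuous_dual (lp p) (lp_norm p)"
proof -
  have V: "subspace (lp p)"
    using quasi_normed_space.subspace[OF quasi_normed_space_lp[OF p]] .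
  have "(c *\<^sub>R x) k = c *\<^sub>R x k" for c and x :: "nat \<Rightarrow> real"
    by (simp add: scaleR_fun_def)
  then have lin: "linear_between (lp p) UNIV (restrict (\<lambda>x. x k) (lp p))"
    unfolding linear_between_def by (simp add: subspace_add[OF V] subspace_scale[OF V])
  have "qn_open (lp p) (lp_norm p) {x \<in> lp p. x k \<in> U}" if U: "open U" for U
    unfolding qn_open_def
  proof (intro conjI ballI)
    fix x assume x: "x \<in> {x \<in> lp p. x k \<in> U}"
    then obtain e where e: "e > 0" "\<And>t. \<bar>t - x k\<bar> < e \<Longrightarrow> t \<in> U"
      using openE[OF U, of "x k"] x by (auto simp: subset_iff dist_real_def abs_minus_commute)
    have "y k \<in> U" if "y \<in> lp p" "lp_norm p (y - x) < e" for y
      using abs_coord_le_lp_norm[of p "y - x" k] lp_diff[OF p, of y x] e(2)[of "y k"] that x p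
      by simp
    then show "\<exists>e>0. \<forall>y\<in>lp p. lp_norm p (y - x) < e \<longrightarrow> y \<in> {x \<in> lp p. x k \<in> U}"
      using e(1) by auto
  qed auto
  moreover have "{x \<in> lp p. restrict (\<lambda>x. x k) (lp p) x \<in> U} = {x \<in> lp p. x k \<in> U}" for U
    by auto
  ultimately have "continuous_map (qn_topology (lp p) (lp_norm p)) euclideanreal
      (restrict (\<lambda>x. x k) (lp p))"
    unfolding continuous_map topspace_qn_topology openin_qn_topology by simp
  with lin show ?thesis by (auto simp: continuous_dual_def)
qed

lemma continuous_map_WOT_coord:
  assumes p: "0 < p" "p < 1" and x: "x \<in> lp p"
  shows "continuous_map (WOT (lp p) (lp_norm p)) euclideanreal (\<lambda>T. T x k)"
proof -
  let ?\<phi> = "restrict (\<lambda>x. x k) (lp p)"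
  have *: "(x, ?\<phi>) \<in> lp p \<times> continuous_dual (lp p) (lp_norm p)"
    using x coord_in_continuous_dual[OF p] by simp
  have top: "topspace (WOT (lp p) (lp_norm p)) = Isom (lp p) (lp_norm p)"
    unfolding WOT_def by (rule topspace_initial_topology[OF *]) auto
  show ?thesis
  \<comment> \<open>Elements of the dual are extensional, so the coordinate enters as a restriction;
    it takes the expected value because \<open>T x\<close> stays in \<open>lp p\<close>.\<close>
  proof (rule continuous_map_eq)
    show "continuous_map (WOT (lp p) (lp_norm p)) euclideanreal (\<lambda>T. ?\<phi> (T x))"
      unfolding WOT_def
      using continuous_map_initial_topology[OF *, of "Isom (lp p) (lp_norm p)"
          "\<lambda>(x, \<phi>) T. \<phi> (T x)" euclideanreal]
      by simp
    show "?\<phi> (T x) = T x k" if "T \<in> topspace (WOT (lp p) (lp_norm p))" for T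
      using that x unfolding top by (auto simp: Isom_def)
  qed
qed

text \<open>Put \<open>d = e powr p / 4\<close>. Since the total masses agree, the tail of
  \<open>y\<close> exceeds that of \<open>z\<close> by at most the head of \<open>y - z\<close>, so
  it is below \<open>2 * d\<close>. The head of \<open>y - z\<close> and the tails of
  \<open>y\<close> and \<open>z\<close> then add up to less than
  \<open>d + 2 * d + d = e powr p\<close>.\<close>

lemma lp_norm_diff_less:
  assumes p: "0 < p" "p < 1" and y: "y \<in> lp p" and z: "z \<in> lp p"
    and norm: "lp_norm p y = lp_norm p z" and e: "0 < e"
    and tail: "(\<Sum>k. \<bar>z (k + n)\<bar> powr p) < e powr p / 4"
    and near: "(\<Sum>k<n. \<bar>y k - z k\<bar> powr p) < e powr p / 4"
  shows "lp_norm p (y - z) < e"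
proof -
  have sm: "summable (\<lambda>k. \<bar>y k\<bar> powr p)" "summable (\<lambda>k. \<bar>z k\<bar> powr p)"
    "summable (\<lambda>k. \<bar>y k - z k\<bar> powr p)"
    using y z lp_diff[OF p y z] by (auto simp: lp_def)
  have "(\<Sum>k. \<bar>y k\<bar> powr p) = (\<Sum>k. \<bar>z k\<bar> powr p)"
  proof -
    have "((\<Sum>k. \<bar>y k\<bar> powr p) powr (1 / p)) powr p = ((\<Sum>k. \<bar>z k\<bar> powr p) powr (1 / p)) powr p"
      using norm by (simp add: lp_norm_def)
    then show ?thesis using p sm by (simp add: powr_powr suminf_nonneg)
  qed
  moreover have "(\<Sum>k<n. \<bar>z k\<bar> powr p) \<le> (\<Sum>k<n. \<bar>y k\<bar> powr p) + (\<Sum>k<n. \<bar>y k - z k\<bar> powr p)"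
    unfolding sum.distrib[symmetric]
  proof (rule sum_mono)
    fix k
    show "\<bar>z k\<bar> powr p \<le> \<bar>y k\<bar> powr p + \<bar>y k - z k\<bar> powr p"
      \<comment> \<open>Here \<open>z k\<close> is written as
        \<open>y k - (y k - z k)\<close>.\<close>
      using abs_diff_powr_le[of p "y k" "y k - z k"] p by simp
  qed
  moreover have "(\<Sum>k. \<bar>y (k + n) - z (k + n)\<bar> powr p)
      \<le> (\<Sum>k. \<bar>y (k + n)\<bar> powr p) + (\<Sum>k. \<bar>z (k + n)\<bar> powr p)"
  proof -
    have sh: "summable (\<lambda>k. \<bar>y (k + n)\<bar> powr p)" "summable (\<lambda>k. \<bar>z (k + n)\<bar> powr p)"
      "summable (\<lambda>k. \<bar>y (k + n) - z (k + n)\<bar> powr p)"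
      using sm[THEN summable_ignore_initial_segment, of n] by auto
    show ?thesis
      unfolding suminf_add[OF sh(1,2)]
      using p by (intro suminf_le abs_diff_powr_le sh summable_add) auto
  qed
  ultimately have "(\<Sum>k. \<bar>y k - z k\<bar> powr p) < e powr p"
    using sm[THEN suminf_split_initial_segment, of n] tail near by linarith
  then have "lp_norm p (y - z) < (e powr p) powr (1 / p)"
    unfolding lp_norm_def using p sm by (auto intro!: powr_less_mono2 suminf_nonneg)
  then show ?thesis using p e by (simp add: powr_powr)
qed

lemma lp_tail_less:
  assumes "z \<in> lp p" "0 < \<epsilon>"
  obtains n where "(\<Sum>k. \<bar>z (k + n)\<bar> powr p) < \<epsilon>"
proof -
  have "summable (\<lambda>k. \<bar>z k\<bar> powr p)" using assms(1) by (simp add: lp_def)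
  from suminf_exist_split[OF assms(2) this]
  obtain n where "norm (\<Sum>k. \<bar>z (k + n)\<bar> powr p) < \<epsilon>" by auto
  then show ?thesis by (intro that[of n]) auto
qed

lemma SOT_le_WOT_lp:
  assumes p: "0 < p" "p < 1" and "openin (SOT (lp p) (lp_norm p)) W"
  shows "openin (WOT (lp p) (lp_norm p)) W"
proof (rule initial_topology_coarsest[OF _ assms(3)[unfolded SOT_def]])
  let ?I = "Isom (lp p) (lp_norm p)" and ?W = "WOT (lp p) (lp_norm p)"
  fix x and U :: "(nat \<Rightarrow> real) set"
  assume x: "x \<in> lp p" and "openin (qn_topology (lp p) (lp_norm p)) U"
  then have U: "qn_open (lp p) (lp_norm p) U" by (simp add: openin_qn_topology)
  have topW: "topspace ?W = ?I"
    unfolding WOT_def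
    \<comment> \<open>The choice of coordinate 0 is arbitrary: one evaluation map suffices to
      identify the underlying set.\<close>
    by (rule topspace_initial_topology[where i = "(x, restrict (\<lambda>x. x 0) (lp p))"])
      (use x coord_in_continuous_dual[OF p] in auto)
  show "openin ?W {T \<in> ?I. T x \<in> U}"
  proof (subst openin_subopen, intro ballI)
    fix T assume "T \<in> {T \<in> ?I. T x \<in> U}"
    then have T: "T \<in> ?I" "T x \<in> U" by auto
    have in_lp: "S x \<in> lp p" and iso: "lp_norm p (S x) = lp_norm p x" if "S \<in> ?I" for S
      using that x by (auto simp: Isom_def)
    obtain e where e: "e > 0" "\<And>y. y \<in> lp p \<Longrightarrow> lp_norm p (y - T x) < e \<Longrightarrow> y \<in> U"
      using U T(2) unfolding qn_open_def by blast
    define \<delta> where "\<delta> = e powr p / 4"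
    have \<delta>: "\<delta> > 0" using e(1) by (simp add: \<delta>_def)
    \<comment> \<open>The cutoff depends on \<open>T x\<close> alone, not on nearby isometries, so
      finitely many coordinates define the weak neighbourhood.\<close>
    obtain n where n: "(\<Sum>k. \<bar>T x (k + n)\<bar> powr p) < \<delta>"
      using lp_tail_less[OF in_lp[OF T(1)] \<delta>] .
    let ?g = "\<lambda>S. \<Sum>k<n. \<bar>S x k - T x k\<bar> powr p"
    have "continuous_map ?W euclideanreal (\<lambda>S. \<bar>S x k - T x k\<bar> powr p)" for k
    proof -
      \<comment> \<open>The base vanishes at \<open>t = T x k\<close>; continuity there comes from
        \<open>0 < p\<close>.\<close>
      have "continuous_on UNIV (\<lambda>t. \<bar>t - T x k\<bar> powr p)"
        using p by (intro continuous_on_powr' continuous_intros) auto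
      then have "continuous_map euclideanreal euclideanreal (\<lambda>t. \<bar>t - T x k\<bar> powr p)"
        by simp
      from continuous_map_compose[OF continuous_map_WOT_coord[OF p x] this]
      show ?thesis by (simp add: o_def)
    qed
    then have "continuous_map ?W euclideanreal ?g" by (intro continuous_map_sum) auto
    from openin_continuous_map_preimage[OF this, of "{..<\<delta>}"]
    have "openin ?W {S \<in> ?I. ?g S < \<delta>}" by (simp add: topW)
    moreover have "T \<in> {S \<in> ?I. ?g S < \<delta>}" using T \<delta> by simp
    moreover have "{S \<in> ?I. ?g S < \<delta>} \<subseteq> {S \<in> ?I. S x \<in> U}"
    proof clarify
      fix S assume S: "S \<in> ?I" "?g S < \<delta>"
      \<comment> \<open>The equal-norm hypothesis holds because \<open>S x\<close> and
        \<open>T x\<close> both have the quasi-norm of \<open>x\<close>.\<close>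
      have "lp_norm p (S x - T x) < e"
        using p e(1) n S T(1) in_lp iso
        by (intro lp_norm_diff_less[where n = n]) (auto simp: \<delta>_def)
      then show "S x \<in> U" using e(2) in_lp[OF S(1)] by blast
    qed
    ultimately show "\<exists>A. openin ?W A \<and> T \<in> A \<and> A \<subseteq> {T \<in> ?I. T x \<in> U}" by blast
  qed
qed

theorem proposition7p1:
  fixes p :: real
  assumes "0 < p" and "p < 1"
  shows "light (lp p) (lp_norm p)"
  unfolding light_def topology_eq using assms SOT_le_WOT_lp WOT_le_SOT by blast

end
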